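(* Let $\mathfrak X$ be a class of groups and suppose that there exists a real number $\gamma$ with $0<\gamma<1$ having the following property: if $X$ is a finite group and the probability that two randomly chosen elements of $X$ generate a group in $\mathfrak X$ is greater than $\gamma$, then $X\in\mathfrak X$. Let $m\leq n$ be positive integers. Then every finite group $G$ such that $G\in\mathfrak X(m,n)$ and $G\notin\mathfrak X$ satisfies $$|G|\leq \left(\frac{2}{1-\gamma}\right)^m(n-1).$$
   Context: A class of groups is understood to be closed under isomorphism. For positive integers $m,n$ and a class of groups $\mathfrak X$, a group $G$ satisfies the condition $\mathfrak X(m,n)$, written $G\in\mathfrak X(m,n)$, if for every two subsets $M$ and $N$ of $G$ of cardinalities $m$ and $n$ respectively (not required to be disjoint), there exist $x\in M$ and $y\in N$ such that the subgroup $\langle x,y\rangle$ belongs to $\mathfrak X$. The probability that two randomly chosen elements of a finite group $X$ generate a group in $\mathfrak X$ is $|\{(x,y)\in X\times X : \langle x,y\rangle\in\mathfrak X\}|/|X|^2$. *)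

theory Defs
  imports Complex_Main "HOL-Algebra.Elementary_Groups"
begin

text \<open>
  A class of groups is a set of groups over a type \<open>'a\<close>, which serves as the universe
  of group elements.  As records are compared also outside their carriers, closure
  under isomorphism is what makes membership independent of those values.
\<close>

definition group_class :: "'a monoid set \<Rightarrow> bool" where
  "group_class \<XX> \<longleftrightarrow>
     (\<forall>G\<in>\<XX>. group G) \<and>
     (\<forall>G H. G \<in> \<XX> \<longrightarrow> group H \<longrightarrow> G \<cong> H \<longrightarrow> H \<in> \<XX>)"

text \<open>
  The condition \<open>\<XX>(m,n)\<close>, for positive \<open>m\<close> and \<open>n\<close>; positivity is what makes
  \<open>card\<close> force \<open>M\<close> and \<open>N\<close> to be finite.
\<close>

definition satisfies_cond :: "'a monoid set \<Rightarrow> nat \<Rightarrow> nat \<Rightarrow> 'a monoid \<Rightarrow> bool" where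
  "satisfies_cond \<XX> m n G \<longleftrightarrow>
     (\<forall>M N. M \<subseteq> carrier G \<longrightarrow> N \<subseteq> carrier G \<longrightarrow> card M = m \<longrightarrow> card N = n \<longrightarrow>
        (\<exists>x\<in>M. \<exists>y\<in>N. subgroup_generated G {x, y} \<in> \<XX>))"

definition pair_probability :: "'a monoid set \<Rightarrow> 'a monoid \<Rightarrow> real" where
  "pair_probability \<XX> X =
     real (card {(x, y). x \<in> carrier X \<and> y \<in> carrier X \<and> subgroup_generated X {x, y} \<in> \<XX>})
       / (real (card (carrier X)))\<^sup>2"

end

theory Submission
  imports Defs
begin

text \<open>
  Call a pair \<open>(x, y)\<close> bad if \<open>x\<close> and \<open>y\<close> generate a subgroup outside \<open>\<XX>\<close>, and put
  \<open>\<delta> = 1 - \<gamma>\<close>.  As \<open>G \<notin> \<XX>\<close>, the hypothesis on \<open>\<gamma>\<close> makes at least a proportion \<open>\<delta>\<close> of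
  all pairs bad.  The condition \<open>\<XX>(m,n)\<close> says that the bipartite graph of bad pairs
  contains no complete bipartite subgraph with parts of sizes \<open>m\<close> and \<open>n\<close>.  Such a graph,
  being dense, has a bounded number of vertices by the theorem of Kovari, Sos and Turan.

  The bound comes from counting the pairs \<open>(M, y)\<close> in which \<open>M\<close> is an \<open>m\<close>-set of bad
  partners of \<open>y\<close>.  There are at most \<open>n - 1\<close> of them for each \<open>M\<close>
  (\<open>sum_choose_degree_le\<close>).  On the other hand, if \<open>y\<close> has \<open>d\<close> bad partners, then it lies in
  \<open>d choose m\<close> of them, which is at least the proportion \<open>((d - (m - 1)) / |G|) ^ m\<close> of all
  \<open>m\<close>-sets (\<open>binomial_proportion_ge\<close>).  The average of \<open>d / |G|\<close> is at least \<open>\<delta>\<close>.  When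
  \<open>2 (m - 1) < \<delta> |G|\<close>, subtracting \<open>m - 1\<close> costs at most half of it, and convexity of the
  \<open>m\<close>-th power (\<open>power_mean_ge\<close>) gives \<open>|G| (\<delta> / 2) ^ m \<le> n - 1\<close>.  This is where the factor
  2 in the bound originates.  When \<open>|G| \<le> (2 / \<delta>) (m - 1)\<close>, the claim holds because
  \<open>m \<le> n\<close> and \<open>2 / \<delta> > 1\<close>.
\<close>

text \<open>
  Jensen's inequality for \<open>x ^ m\<close>: Bernoulli's inequality supplies the tangent at \<open>c\<close>, which
  is then summed.
\<close>

lemma power_mean_ge:
  fixes t :: "'b \<Rightarrow> real"
  assumes nonneg: "\<And>y. y \<in> B \<Longrightarrow> 0 \<le> t y" and c: "0 < c"
    and mean: "real (card B) * c \<le> (\<Sum>y\<in>B. t y)"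
  shows "real (card B) * c ^ m \<le> (\<Sum>y\<in>B. t y ^ m)"
proof -
  have tangent: "c ^ m * (1 + real m * (t y / c - 1)) \<le> t y ^ m" if "y \<in> B" for y
  proof -
    have "-1 \<le> t y / c - 1" using nonneg[OF that] c by simp
    from Bernoulli_inequality[OF this, of m]
    have "c ^ m * (1 + real m * (t y / c - 1)) \<le> c ^ m * (t y / c) ^ m"
      using c by simp
    also have "\<dots> = t y ^ m" using c by (simp add: power_divide)
    finally show ?thesis .
  qed
  have "0 \<le> c ^ m * real m * ((\<Sum>y\<in>B. t y) / c - real (card B))"
    using mean c by (intro mult_nonneg_nonneg) (simp_all add: field_simps)
  hence "real (card B) * c ^ m
      \<le> real (card B) * c ^ m + c ^ m * real m * ((\<Sum>y\<in>B. t y) / c - real (card B))"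
    by simp
  also have "\<dots> = (\<Sum>y\<in>B. c ^ m * (1 + real m * (t y / c - 1)))"
    by (simp add: sum_distrib_left[symmetric] sum_distrib_right[symmetric] sum.distrib sum_subtractf
        sum_divide_distrib[symmetric] algebra_simps)
  also have "\<dots> \<le> (\<Sum>y\<in>B. t y ^ m)"
    by (rule sum_mono) (rule tangent)
  finally show ?thesis .
qed

text \<open>
  The proportion of \<open>m\<close>-subsets of an \<open>a\<close>-set inside a \<open>d\<close>-subset is the product of the
  fractions \<open>(d - i) / (a - i)\<close> for \<open>i < m\<close>, each at least \<open>(d - (m - 1)) / a\<close>.  The truncated
  subtraction makes the bound vanish for \<open>d < m\<close>, when there are no such subsets.
\<close>

lemma binomial_proportion_ge:
  assumes "1 \<le> m" and "d \<le> a"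
  shows "(real (d - (m - 1)) / real a) ^ m * real (a choose m) \<le> real (d choose m)"
proof (cases "m \<le> d")
  case False
  thus ?thesis using assms by (simp add: power_0_left)
next
  case True
  with assms have "m \<le> a" and a: "0 < real a" by auto
  let ?q = "real (d - (m - 1)) / real a"
  have "?q ^ m * real (a choose m) = (\<Prod>i=0..<m. ?q * (real (a - i) / real (m - i)))"
    by (simp only: binomial_altdef_of_nat[OF \<open>m \<le> a\<close>] prod.distrib prod_constant
        card_atLeastLessThan diff_zero)
  also have "\<dots> \<le> (\<Prod>i=0..<m. real (d - i) / real (m - i))"
  proof (rule prod_mono, intro conjI)
    fix i assume "i \<in> {0..<m}"
    hence i: "i < m" by simp
    have "?q * real (a - i) \<le> ?q * real a"
      by (intro mult_left_mono) auto
    also have "\<dots> = real (d - (m - 1))" using a by simp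
    also have "\<dots> \<le> real (d - i)" using i by simp
    finally show "?q * (real (a - i) / real (m - i)) \<le> real (d - i) / real (m - i)"
      using divide_right_mono[of "?q * real (a - i)" "real (d - i)" "real (m - i)"] by simp
  qed simp
  also have "\<dots> = real (d choose m)"
    by (simp add: binomial_altdef_of_nat[OF True])
  finally show ?thesis .
qed

text \<open>
  Both sides count the pairs of an \<open>m\<close>-set \<open>M\<close> and a common neighbour \<open>y\<close> of \<open>M\<close>: the left
  exactly, grouped by \<open>y\<close>, the right from above, grouped by \<open>M\<close>.
\<close>

lemma sum_choose_degree_le:
  assumes "finite A" and "finite B"
    and common: "\<And>M. M \<subseteq> A \<Longrightarrow> card M = m \<Longrightarrow> card {y \<in> B. \<forall>x\<in>M. R x y} \<le> k"
  shows "(\<Sum>y\<in>B. card {x \<in> A. R x y} choose m) \<le> (card A choose m) * k"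
proof -
  let ?S = "{M. M \<subseteq> A \<and> card M = m}"
  have finS: "finite ?S" using \<open>finite A\<close> by simp
  have "(\<Sum>y\<in>B. card {x \<in> A. R x y} choose m) = (\<Sum>y\<in>B. card {M \<in> ?S. \<forall>x\<in>M. R x y})"
  proof (rule sum.cong[OF refl])
    fix y
    have "{M \<in> ?S. \<forall>x\<in>M. R x y} = {M. M \<subseteq> {x \<in> A. R x y} \<and> card M = m}"
      by auto
    thus "(card {x \<in> A. R x y} choose m) = card {M \<in> ?S. \<forall>x\<in>M. R x y}"
      using n_subsets[of "{x \<in> A. R x y}" m] \<open>finite A\<close> by simp
  qed
  also have "\<dots> = (\<Sum>M\<in>?S. card {y \<in> B. \<forall>x\<in>M. R x y})"
    by (rule sum_multicount_gen[OF \<open>finite B\<close> finS]) simp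
  also have "\<dots> \<le> (\<Sum>M\<in>?S. k)"
    by (rule sum_mono) (use common in auto)
  also have "\<dots> = (card A choose m) * k"
    using n_subsets[OF \<open>finite A\<close>, of m] by simp
  finally show ?thesis .
qed

text \<open>
  The Kovari--Sos--Turan bound in density form.  The bound on \<open>m\<close> ensures that after the
  loss of \<open>m - 1\<close> in every degree the average relative degree is still at least \<open>\<delta> / 2\<close>.
\<close>

lemma dense_relation_bound:
  assumes "finite A" and "finite B" and \<delta>: "0 < \<delta>" "\<delta> \<le> 1" and m: "1 \<le> m"
    and large: "2 * (real m - 1) < \<delta> * real (card A)"
    and dense: "\<delta> * real (card A) * real (card B) \<le> real (card {(x, y) \<in> A \<times> B. R x y})"
    and common: "\<And>M. M \<subseteq> A \<Longrightarrow> card M = m \<Longrightarrow> card {y \<in> B. \<forall>x\<in>M. R x y} \<le> k"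
  shows "real (card B) \<le> (2 / \<delta>) ^ m * real k"
proof -
  let ?a = "card A"
  let ?C = "real (?a choose m)"
  define d where "d y = card {x \<in> A. R x y}" for y
  define t where "t y = real (d y - (m - 1)) / real ?a" for y
  have "real m - 1 \<le> 2 * (real m - 1)" using m by simp
  also have "\<dots> < \<delta> * real ?a" by (rule large)
  also have "\<dots> \<le> real ?a"
    using \<delta> mult_right_mono[of \<delta> 1 "real ?a"] by simp
  finally have "real m - 1 < real ?a" .
  hence "m \<le> ?a" by linarith
  with m have a: "0 < real ?a" and C: "0 < ?C" by (simp_all add: zero_less_binomial)
  have "card {(x, y) \<in> A \<times> B. R x y} = card (SIGMA y:B. {x \<in> A. R x y})"
    by (rule bij_betw_same_card[of prod.swap]) (force simp: bij_betw_def inj_on_def)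
  also have "\<dots> = (\<Sum>y\<in>B. d y)"
    using \<open>finite A\<close> \<open>finite B\<close> by (simp add: d_def)
  finally have edges: "\<delta> * real ?a * real (card B) \<le> (\<Sum>y\<in>B. real (d y))"
    using dense by simp
  have "real (card B) * (\<delta> / 2) * real ?a
      \<le> \<delta> * real ?a * real (card B) - real (card B) * (real m - 1)"
    using mult_left_mono[OF less_imp_le[OF large], of "real (card B)"]
    by (simp add: algebra_simps)
  also have "\<dots> \<le> (\<Sum>y\<in>B. real (d y) - (real m - 1))"
    using edges by (simp add: sum_subtractf)
  also have "\<dots> \<le> (\<Sum>y\<in>B. real (d y - (m - 1)))"
    by (rule sum_mono) (use m in linarith)
  also have "\<dots> = (\<Sum>y\<in>B. t y) * real ?a"
    using a by (simp add: t_def sum_divide_distrib[symmetric])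
  finally have mean: "real (card B) * (\<delta> / 2) \<le> (\<Sum>y\<in>B. t y)"
    using a by simp
  have "real (card B) * (\<delta> / 2) ^ m * ?C \<le> (\<Sum>y\<in>B. t y ^ m) * ?C"
    by (rule mult_right_mono[OF power_mean_ge[OF _ _ mean]]) (use \<delta> in \<open>auto simp: t_def\<close>)
  also have "\<dots> = (\<Sum>y\<in>B. t y ^ m * ?C)"
    by (rule sum_distrib_right)
  also have "\<dots> \<le> (\<Sum>y\<in>B. real (d y choose m))"
    unfolding t_def d_def
    by (intro sum_mono binomial_proportion_ge m card_mono \<open>finite A\<close>) auto
  also have "\<dots> \<le> real ((?a choose m) * k)"
    unfolding d_def of_nat_sum[symmetric] of_nat_le_iff
    using sum_choose_degree_le[OF \<open>finite A\<close> \<open>finite B\<close> common] .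
  finally have "real (card B) * (\<delta> / 2) ^ m \<le> real k"
    using C by (simp add: mult.commute)
  hence "(2 / \<delta>) ^ m * (real (card B) * (\<delta> / 2) ^ m) \<le> (2 / \<delta>) ^ m * real k"
    using \<delta> by (intro mult_left_mono) auto
  also have "(2 / \<delta>) ^ m * (real (card B) * (\<delta> / 2) ^ m)
      = real (card B) * ((2 / \<delta>) * (\<delta> / 2)) ^ m"
    unfolding power_mult_distrib by (simp only: ac_simps)
  finally show ?thesis using \<delta> by simp
qed

theorem theorem1:
  fixes \<XX> :: "'a monoid set" and \<gamma> :: real and m n :: nat and G :: "'a monoid"
  assumes "group_class \<XX>"
    and "0 < \<gamma>" and "\<gamma> < 1"
    and "\<And>X :: 'a monoid. group X \<Longrightarrow> finite (carrier X) \<Longrightarrow>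
           pair_probability \<XX> X > \<gamma> \<Longrightarrow> X \<in> \<XX>"
    and "1 \<le> m" and "m \<le> n"
    and "group G" and "finite (carrier G)"
    and "satisfies_cond \<XX> m n G" and "G \<notin> \<XX>"
  shows "real (card (carrier G)) \<le> (2 / (1 - \<gamma>)) ^ m * (real n - 1)"
proof -
  let ?A = "carrier G"
  let ?g = "card ?A"
  let ?R = "\<lambda>x y. subgroup_generated G {x, y} \<notin> \<XX>"
  define \<delta> where "\<delta> = 1 - \<gamma>"
  have \<delta>: "0 < \<delta>" "\<delta> \<le> 1" using assms by (auto simp: \<delta>_def)
  note fin = \<open>finite ?A\<close>
  have "?A \<noteq> {}" using \<open>group G\<close> by (simp add: group.is_monoid monoid.carrier_not_empty)
  hence g: "0 < real ?g" using fin by (simp add: card_gt_0_iff)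
  show ?thesis
  proof (cases "2 * (real m - 1) < \<delta> * real ?g")
    case True
    let ?good = "{(x, y). x \<in> ?A \<and> y \<in> ?A \<and> subgroup_generated G {x, y} \<in> \<XX>}"
    let ?bad = "{(x, y) \<in> ?A \<times> ?A. ?R x y}"
    have "pair_probability \<XX> G \<le> \<gamma>"
      using assms by (meson not_le)
    hence good: "real (card ?good) \<le> \<gamma> * (real ?g)\<^sup>2"
      using g by (simp add: pair_probability_def field_simps)
    have split: "?A \<times> ?A = ?good \<union> ?bad" by auto
    have "finite (?good \<union> ?bad)" unfolding split[symmetric] using fin by simp
    hence "card (?good \<union> ?bad) = card ?good + card ?bad"
      by (intro card_Un_disjoint) auto
    hence "card (?A \<times> ?A) = card ?good + card ?bad"
      by (simp only: split[symmetric])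
    hence "(real ?g)\<^sup>2 = real (card ?good) + real (card ?bad)"
      by (simp add: card_cartesian_product power2_eq_square flip: of_nat_mult of_nat_add)
    with good have dense: "\<delta> * real ?g * real ?g \<le> real (card ?bad)"
      by (simp add: \<delta>_def algebra_simps power2_eq_square)
    have common: "card {y \<in> ?A. \<forall>x\<in>M. ?R x y} \<le> n - 1" if M: "M \<subseteq> ?A" "card M = m" for M
    proof (rule ccontr)
      assume "\<not> ?thesis"
      hence "n \<le> card {y \<in> ?A. \<forall>x\<in>M. ?R x y}" by simp
      then obtain N where N: "N \<subseteq> {y \<in> ?A. \<forall>x\<in>M. ?R x y}" "card N = n"
        by (meson obtain_subset_with_card_n)
      hence "N \<subseteq> ?A" by auto
      with M N \<open>satisfies_cond \<XX> m n G\<close>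
      obtain x y where "x \<in> M" "y \<in> N" "subgroup_generated G {x, y} \<in> \<XX>"
        unfolding satisfies_cond_def by metis
      with N show False by auto
    qed
    from dense_relation_bound[OF fin fin \<delta> \<open>1 \<le> m\<close> True dense common]
    show ?thesis using assms by (simp add: \<delta>_def of_nat_diff)
  next
    case False
    hence "real ?g \<le> 2 / \<delta> * (real m - 1)"
      using \<delta> by (simp add: field_simps)
    also have "\<dots> \<le> (2 / \<delta>) ^ m * (real n - 1)"
    proof (rule mult_mono)
      show "2 / \<delta> \<le> (2 / \<delta>) ^ m"
        using \<delta> assms power_increasing[of 1 m "2 / \<delta>"] by (simp add: field_simps)
    qed (use \<delta> assms in auto)
    finally show ?thesis by (simp add: \<delta>_def)
  qed
qed

end
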